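(* Let $\tau,\kappa,\nu:\mathbb{Z}^3\to\mathbb{R}\setminus\{0\}$ satisfy, in shift notation, $$\nu(\tau\tau_{123}-\tau_3\tau_{12})+\kappa_1(\tau_2\tau_3-\tau\tau_{23})+\kappa_2(\tau\tau_{13}-\tau_1\tau_3)=0,$$ $$\kappa_2(\tau\kappa_{12}-\tau_1\nu_2)+\tau_2(\nu_1\kappa_2-\tau_3\tau_{12})+\tau_{12}(\tau\tau_{23}-\nu\nu_2)=0,$$ $$\nu(\kappa_1\nu_2-\kappa_2\nu_1)+\kappa_1(\tau_2\tau_3-\tau\tau_{23})+\kappa_2(\tau\tau_{13}-\tau_1\tau_3)=0.$$ Then the linear lattice equations for $\Phi,\Psi,\boldsymbol\chi:\mathbb{Z}^3\to\mathbb{C}$ $$\Phi_{12}-\Phi=\frac{\tau_1\tau_2}{\tau\tau_{12}}(\Phi_1-\Phi_2),\qquad \boldsymbol\chi_1-\Phi=\frac{\nu\tau_1}{\kappa_1\tau}(\Phi_1-\Psi),$$ $$\Phi_{13}-\Psi=\frac{\kappa_1\tau_3}{\nu\tau_{13}}(\boldsymbol\chi_1-\Phi_3),\qquad \boldsymbol\chi_2-\Phi=\frac{\nu\tau_2}{\kappa_2\tau}(\Phi_2-\Psi),$$ $$\Phi_{23}-\Psi=\frac{\kappa_2\tau_3}{\nu\tau_{23}}(\boldsymbol\chi_2-\Phi_3),\qquad \Psi-\boldsymbol\chi=\frac{\tau\tau_3}{\kappa\nu}(\Phi_3-\Phi)$$ are compatible, and for any solution, at every point of $\mathbb{Z}^3$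 the points $\Psi,\boldsymbol\chi_{12},\Phi_1,\Phi_2,\Phi_{13},\Phi_{23}$ and $\Psi_1,\Psi_2,\boldsymbol\chi_1,\boldsymbol\chi_2,\Phi,\Phi_3,\Phi_{12},\Phi_{123}$ form a reciprocal pair of octahedral and hexahedral figures obeying the multi-ratio relations $$M(\Phi_{23},\Phi_{13},\Psi,\Phi_1,\Phi_2,\boldsymbol\chi_{12})=M(\Phi_{123},\Phi_3,\boldsymbol\chi_1,\Phi,\Phi_{12},\Psi_2),$$ $$M(\Phi_{13},\Phi_{23},\Psi,\Phi_2,\Phi_1,\boldsymbol\chi_{12})=M(\Phi_{123},\Phi_3,\boldsymbol\chi_2,\Phi,\Phi_{12},\Psi_1),$$ $$M(\boldsymbol\chi_{12},\Phi_{23},\Phi_2,\Psi,\Phi_1,\Phi_{13})=M(\Phi_{123},\Psi_2,\boldsymbol\chi_2,\Phi,\boldsymbol\chi_1,\Psi_1).$$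
   Context: Shift notation: for $f$ on $\mathbb{Z}^3$, $f=f(n_1,n_2,n_3)$, $f_1=f(n_1+1,n_2,n_3)$, $f_{12}=f(n_1+1,n_2+1,n_3)$, etc. $M(P_1,\dots,P_6)=\frac{(P_1-P_2)(P_3-P_4)(P_5-P_6)}{(P_2-P_3)(P_4-P_5)(P_6-P_1)}$. An octahedral figure with vertices $\Psi,\boldsymbol\chi_{12},\Phi_1,\Phi_2,\Phi_{13},\Phi_{23}$ has the twelve straight edges $\Phi_1\Phi_2$, $\Psi\Phi_1$, $\Psi\Phi_2$, $\Psi\Phi_{13}$, $\Psi\Phi_{23}$, $\Phi_{13}\Phi_{23}$, $\boldsymbol\chi_{12}\Phi_{13}$, $\boldsymbol\chi_{12}\Phi_{23}$, $\boldsymbol\chi_{12}\Phi_1$, $\boldsymbol\chi_{12}\Phi_2$, $\Phi_1\Phi_{13}$, $\Phi_2\Phi_{23}$. A hexahedral figure with vertices $\Psi_1,\Psi_2,\boldsymbol\chi_1,\boldsymbol\chi_2,\Phi,\Phi_3,\Phi_{12},\Phi_{123}$ is reciprocal to it when its twelve edges $\Phi\Phi_{12}$, $\Phi\boldsymbol\chi_1$, $\Phi\boldsymbol\chi_2$, $\boldsymbol\chi_1\Phi_3$, $\boldsymbol\chi_2\Phi_3$, $\Phi_3\Phi_{123}$, $\Psi_1\Phi_{123}$, $\Psi_2\Phi_{123}$, $\Phi_{12}\Psi_1$, $\Phi_{12}\Psi_2$, $\boldsymbol\chi_1\Psi_1$, $\boldsymbol\chi_2\Psi_2$ are respectively parallel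 to the twelve edges listed for the octahedral figure. *)

theory Defs
  imports Complex_Main
begin

type_synonym pt = "int \<times> int \<times> int"

text \<open>Unit shifts on Z^3: f_1 = f (s1 n), f_12 = f (s1 (s2 n)), etc.\<close>
definition s1 :: "pt \<Rightarrow> pt" where "s1 = (\<lambda>(a, b, c). (a + 1, b, c))"
definition s2 :: "pt \<Rightarrow> pt" where "s2 = (\<lambda>(a, b, c). (a, b + 1, c))"
definition s3 :: "pt \<Rightarrow> pt" where "s3 = (\<lambda>(a, b, c). (a, b, c + 1))"

definition M :: "complex \<Rightarrow> complex \<Rightarrow> complex \<Rightarrow> complex \<Rightarrow> complex \<Rightarrow> complex \<Rightarrow> complex" where
  "M P1 P2 P3 P4 P5 P6 =
     ((P1 - P2) * (P3 - P4) * (P5 - P6)) / ((P2 - P3) * (P4 - P5) * (P6 - P1))"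

text \<open>Two plane vectors (complex numbers) are parallel iff they are real-linearly dependent.\<close>
definition parallel :: "complex \<Rightarrow> complex \<Rightarrow> bool" where
  "parallel z w \<longleftrightarrow> Im (z * cnj w) = 0"

definition lin_system ::
  "(pt \<Rightarrow> real) \<Rightarrow> (pt \<Rightarrow> real) \<Rightarrow> (pt \<Rightarrow> real) \<Rightarrow>
   (pt \<Rightarrow> complex) \<Rightarrow> (pt \<Rightarrow> complex) \<Rightarrow> (pt \<Rightarrow> complex) \<Rightarrow> bool" where
  "lin_system \<tau> \<kappa> \<nu> \<Phi> \<Psi> \<chi> \<longleftrightarrow> (\<forall>n.
     \<Phi> (s1 (s2 n)) - \<Phi> n
       = complex_of_real ((\<tau> (s1 n) * \<tau> (s2 n)) / (\<tau> n * \<tau> (s1 (s2 n)))) * (\<Phi> (s1 n) - \<Phi> (s2 n)) \<and>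
     \<chi> (s1 n) - \<Phi> n
       = complex_of_real ((\<nu> n * \<tau> (s1 n)) / (\<kappa> (s1 n) * \<tau> n)) * (\<Phi> (s1 n) - \<Psi> n) \<and>
     \<Phi> (s1 (s3 n)) - \<Psi> n
       = complex_of_real ((\<kappa> (s1 n) * \<tau> (s3 n)) / (\<nu> n * \<tau> (s1 (s3 n)))) * (\<chi> (s1 n) - \<Phi> (s3 n)) \<and>
     \<chi> (s2 n) - \<Phi> n
       = complex_of_real ((\<nu> n * \<tau> (s2 n)) / (\<kappa> (s2 n) * \<tau> n)) * (\<Phi> (s2 n) - \<Psi> n) \<and>
     \<Phi> (s2 (s3 n)) - \<Psi> n
       = complex_of_real ((\<kappa> (s2 n) * \<tau> (s3 n)) / (\<nu> n * \<tau> (s2 (s3 n)))) * (\<chi> (s2 n) - \<Phi> (s3 n)) \<and>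
     \<Psi> n - \<chi> n
       = complex_of_real ((\<tau> n * \<tau> (s3 n)) / (\<kappa> n * \<nu> n)) * (\<Phi> (s3 n) - \<Phi> n))"

text \<open>Compatibility (consistency on the elementary cube): at every point n, for arbitrary
  free data \<Phi>, \<Phi>_1, \<Phi>_2, \<Phi>_3, \<Psi> at the cube, the quantities determined by the
  lattice equations do not depend on the order in which they are computed:
  \<chi>_12 obtained from the second equation shifted in direction 2 coincides with \<chi>_12
  obtained from the fourth equation shifted in direction 1, and the three values of
  \<Phi>_123 obtained from the first equation shifted in direction 3, the third shifted in
  direction 2 and the fifth shifted in direction 1 coincide.
  (\<chi>_1, \<chi>_2, \<Phi>_12, \<Phi>_13, \<Phi>_23 come from equations 2,4,1,3,5 at n, and
  \<Psi>_1, \<Psi>_2 from the sixth equation shifted in directions 1 and 2.)\<close>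
definition lin_compatible :: "(pt \<Rightarrow> real) \<Rightarrow> (pt \<Rightarrow> real) \<Rightarrow> (pt \<Rightarrow> real) \<Rightarrow> bool" where
  "lin_compatible \<tau> \<kappa> \<nu> \<longleftrightarrow> (\<forall>n F F1 F2 F3 P :: complex.
     let A  = (\<lambda>m. complex_of_real ((\<tau> (s1 m) * \<tau> (s2 m)) / (\<tau> m * \<tau> (s1 (s2 m)))));
         B1 = (\<lambda>m. complex_of_real ((\<nu> m * \<tau> (s1 m)) / (\<kappa> (s1 m) * \<tau> m)));
         C1 = (\<lambda>m. complex_of_real ((\<kappa> (s1 m) * \<tau> (s3 m)) / (\<nu> m * \<tau> (s1 (s3 m)))));
         B2 = (\<lambda>m. complex_of_real ((\<nu> m * \<tau> (s2 m)) / (\<kappa> (s2 m) * \<tau> m)));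
         C2 = (\<lambda>m. complex_of_real ((\<kappa> (s2 m) * \<tau> (s3 m)) / (\<nu> m * \<tau> (s2 (s3 m)))));
         D  = (\<lambda>m. complex_of_real ((\<tau> m * \<tau> (s3 m)) / (\<kappa> m * \<nu> m)));
         F12 = F + A n * (F1 - F2);
         X1 = F + B1 n * (F1 - P);
         X2 = F + B2 n * (F2 - P);
         F13 = P + C1 n * (X1 - F3);
         F23 = P + C2 n * (X2 - F3);
         P1 = X1 + D (s1 n) * (F13 - F1);
         P2 = X2 + D (s2 n) * (F23 - F2);
         X12 = F2 + B1 (s2 n) * (F12 - P2);
         X12' = F1 + B2 (s1 n) * (F12 - P1);
         F123 = F3 + A (s3 n) * (F13 - F23);
         F123' = P2 + C1 (s2 n) * (X12 - F23);
         F123'' = P1 + C2 (s1 n) * (X12 - F13)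
     in X12 = X12' \<and> F123 = F123' \<and> F123 = F123'')"

end

theory Submission
  imports Defs
begin

text \<open>
  By the third equation of the \<open>\<tau>\<close>-system, the quantities \<open>(\<nu>\<nu>\<^sub>i - \<tau>\<tau>\<^sub>i\<^sub>3 + \<tau>\<^sub>i\<tau>\<^sub>3)/\<kappa>\<^sub>i\<close> agree
  for \<open>i = 1, 2\<close>. In terms of their common value \<open>S\<close>, the first two become
  \<open>\<tau>\<kappa>\<^sub>1\<^sub>2 = \<tau>\<^sub>1\<nu>\<^sub>2 - \<tau>\<^sub>2\<nu>\<^sub>1 + \<tau>\<^sub>1\<^sub>2S\<close> and \<open>\<tau>\<tau>\<^sub>1\<^sub>2\<^sub>3 = \<tau>\<^sub>3\<tau>\<^sub>1\<^sub>2 + \<kappa>\<^sub>1\<nu>\<^sub>2 - \<kappa>\<^sub>2\<nu>\<^sub>1\<close>, and the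
  multiply determined points have closed forms that are visibly independent of the order of
  computation. The parallelism and the multi-ratio relations need no more than the linear
  equations: each of them expresses an edge of one figure as a nonzero real multiple of an edge
  of the other, and in each multi-ratio the product of the multipliers telescopes to 1.
\<close>

section \<open>Consistency on the elementary cube\<close>

text \<open>Clearing denominators and eliminating \<open>Xi\<close> gives both forms. The index
  \<open>i\<close> stands for direction 1 or 2. In the second form the coefficient of
  \<open>Fi - P\<close> collects to \<open>ki * S\<close>, so \<open>ki\<close> cancels.\<close>

lemma psi_shift:
  fixes t :: "'a::field"
  assumes nz: "t \<noteq> 0" "ti \<noteq> 0" "t3 \<noteq> 0" "ti3 \<noteq> 0" "ki \<noteq> 0" "v \<noteq> 0" "vi \<noteq> 0"
    and S: "ki * S = v * vi - t * ti3 + ti * t3"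
    and Xi: "Xi = F + v * ti / (ki * t) * (Fi - P)"
    and Fi3: "Fi3 = P + ki * t3 / (v * ti3) * (Xi - F3)"
    and Pi: "Pi = Xi + ti * ti3 / (ki * vi) * (Fi3 - Fi)"
  shows "v * t * ti3 * (Fi3 - P) = v * ti * t3 * (Fi - P) - ki * t * t3 * (F3 - F)"
    and "v * t * vi * (Pi - F) = ti * (v * S * (Fi - P) - t * t3 * (F3 - F))"
proof -
  have X: "ki * t * (Xi - F) = v * ti * (Fi - P)"
    using nz unfolding Xi by (simp add: field_simps)
  have Y: "v * ti3 * (Fi3 - P) = ki * t3 * (Xi - F3)"
    using nz unfolding Fi3 by simp
  have Z: "ki * vi * (Pi - Xi) = ti * ti3 * (Fi3 - Fi)"
    using nz unfolding Pi by simp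
  show *: "v * t * ti3 * (Fi3 - P) = v * ti * t3 * (Fi - P) - ki * t * t3 * (F3 - F)"
    using X Y by algebra
  have "ki * (v * t * vi * (Pi - F)) = ki * (ti * (v * S * (Fi - P) - t * t3 * (F3 - F)))"
    using * X Z S by algebra
  then show "v * t * vi * (Pi - F) = ti * (v * S * (Fi - P) - t * t3 * (F3 - F))"
    using nz by simp
qed

text \<open>After \<open>Fij\<close> and \<open>Pj\<close> are eliminated, the relation
  \<open>k\<close> absorbs the remaining multiple of \<open>Fj - F\<close>. Interchanging
  \<open>i\<close> and \<open>j\<close> while negating \<open>tij\<close> and \<open>kij\<close>
  negates both sides, so both routes to this point yield the same equation.\<close>

lemma chi12_closed_form:
  fixes t :: "'a::field"
  assumes nz: "t \<noteq> 0" "ti \<noteq> 0" "tj \<noteq> 0" "tij \<noteq> 0" "kij \<noteq> 0" "v \<noteq> 0" "vj \<noteq> 0"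
    and k: "t * kij = ti * vj - tj * vi + tij * S"
    and Pj: "v * t * vj * (Pj - F) = tj * (v * S * (Fj - P) - t * t3 * (F3 - F))"
    and Fij: "Fij = F + ti * tj / (t * tij) * (Fi - Fj)"
    and Xij: "Xij = Fj + vj * tij / (kij * tj) * (Fij - Pj)"
  shows "v * t * kij * (Xij - F) =
    v * (ti * vj * (Fi - F) - tj * vi * (Fj - F) + tij * S * (P - F)) + tij * t * t3 * (F3 - F)"
proof -
  have Y: "t * tij * (Fij - F) = ti * tj * (Fi - Fj)"
    using nz unfolding Fij by simp
  have X: "kij * tj * (Xij - Fj) = vj * tij * (Fij - Pj)"
    using nz unfolding Xij by simp
  have "tj * (v * t * kij * (Xij - F)) = tj * (v * (ti * vj * (Fi - F) - tj * vi * (Fj - F)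
      + tij * S * (P - F)) + tij * t * t3 * (F3 - F))"
    using X Y Pj k by algebra
  then show ?thesis using nz by simp
qed

text \<open>Substituting the closed forms makes the two values a polynomial identity modulo the
  coefficient relations. Interchanging the two directions yields the comparison with the third
  value.\<close>

lemma phi123_consistent:
  fixes t :: "'a::field"
  assumes nz: "t \<noteq> 0" "t3 \<noteq> 0" "ti3 \<noteq> 0" "tj3 \<noteq> 0" "t123 \<noteq> 0" "kij \<noteq> 0" "v \<noteq> 0" "vj \<noteq> 0"
    and Si: "ki * S = v * vi - t * ti3 + ti * t3"
    and Sj: "kj * S = v * vj - t * tj3 + tj * t3"
    and k: "t * kij = ti * vj - tj * vi + tij * S"
    and t123: "t * t123 = t3 * tij + ki * vj - kj * vi"
    and Fi3: "v * t * ti3 * (Fi3 - P) = v * ti * t3 * (Fi - P) - ki * t * t3 * (F3 - F)"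
    and Fj3: "v * t * tj3 * (Fj3 - P) = v * tj * t3 * (Fj - P) - kj * t * t3 * (F3 - F)"
    and Pj: "v * t * vj * (Pj - F) = tj * (v * S * (Fj - P) - t * t3 * (F3 - F))"
    and Xij: "v * t * kij * (Xij - F) =
      v * (ti * vj * (Fi - F) - tj * vi * (Fj - F) + tij * S * (P - F)) + tij * t * t3 * (F3 - F)"
  shows "F3 + ti3 * tj3 / (t3 * t123) * (Fi3 - Fj3) = Pj + kij * tj3 / (vj * t123) * (Xij - Fj3)"
proof -
  define a where "a = ti3 * tj3 / (t3 * t123) * (Fi3 - Fj3)"
  define b where "b = kij * tj3 / (vj * t123) * (Xij - Fj3)"
  have a: "t3 * t123 * a = ti3 * tj3 * (Fi3 - Fj3)"
    using nz unfolding a_def by simp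
  have b: "vj * t123 * b = kij * tj3 * (Xij - Fj3)"
    using nz unfolding b_def by simp
  \<comment> \<open>The closed forms determine their points only after multiplication by
    \<open>v * t\<close>, and \<open>k\<close> and \<open>t123\<close> carry one more
    \<open>t\<close>. The prefactor lets all of them be substituted without division.\<close>
  have "t * v * t * (vj * (ti3 * tj3 * (Fi3 - Fj3) + t3 * t123 * F3)) =
        t * v * t * (t3 * (kij * tj3 * (Xij - Fj3) + vj * t123 * Pj))"
    using Fi3 Fj3 Pj Xij Si Sj k t123 by algebra
  then have "t * v * t * t3 * t123 * vj * (F3 + a) = t * v * t * t3 * t123 * vj * (Pj + b)"
    using a b by algebra
  then show ?thesis using nz by (simp add: a_def b_def)
qed

text \<open>Interchanging the directions 1 and 2 leaves the system invariant up to changing the signs of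
  \<open>\<tau>\<^sub>1\<^sub>2\<close>, \<open>\<kappa>\<^sub>1\<^sub>2\<close> and \<open>\<tau>\<^sub>1\<^sub>2\<^sub>3\<close>, hence the negated instances below.\<close>

lemma cube_consistent:
  fixes t :: "'a::field"
  assumes nz: "t \<noteq> 0" "t1 \<noteq> 0" "t2 \<noteq> 0" "t3 \<noteq> 0" "t12 \<noteq> 0" "t13 \<noteq> 0" "t23 \<noteq> 0" "t123 \<noteq> 0"
      "k1 \<noteq> 0" "k2 \<noteq> 0" "k12 \<noteq> 0" "v \<noteq> 0" "v1 \<noteq> 0" "v2 \<noteq> 0"
    and eq1: "v * (t * t123 - t3 * t12) + k1 * (t2 * t3 - t * t23) + k2 * (t * t13 - t1 * t3) = 0"
    and eq2: "k2 * (t * k12 - t1 * v2) + t2 * (v1 * k2 - t3 * t12) + t12 * (t * t23 - v * v2) = 0"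
    and eq3: "v * (k1 * v2 - k2 * v1) + k1 * (t2 * t3 - t * t23) + k2 * (t * t13 - t1 * t3) = 0"
    and F12: "F12 = F + t1 * t2 / (t * t12) * (F1 - F2)"
    and X1: "X1 = F + v * t1 / (k1 * t) * (F1 - P)"
    and X2: "X2 = F + v * t2 / (k2 * t) * (F2 - P)"
    and F13: "F13 = P + k1 * t3 / (v * t13) * (X1 - F3)"
    and F23: "F23 = P + k2 * t3 / (v * t23) * (X2 - F3)"
    and P1: "P1 = X1 + t1 * t13 / (k1 * v1) * (F13 - F1)"
    and P2: "P2 = X2 + t2 * t23 / (k2 * v2) * (F23 - F2)"
    and X12: "X12 = F2 + v2 * t12 / (k12 * t2) * (F12 - P2)"
    and X12': "X12' = F1 + v1 * t12 / (k12 * t1) * (F12 - P1)"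
  shows "X12 = X12'"
    and "F3 + t13 * t23 / (t3 * t123) * (F13 - F23) = P2 + k12 * t23 / (v2 * t123) * (X12 - F23)"
    and "F3 + t13 * t23 / (t3 * t123) * (F13 - F23) = P1 + k12 * t13 / (v1 * t123) * (X12 - F13)"
proof -
  define S where "S = (v * v1 - t * t13 + t1 * t3) / k1"
  have S1: "k1 * S = v * v1 - t * t13 + t1 * t3"
    using nz by (simp add: S_def)
  have "k1 * (k2 * S) = k1 * (v * v2 - t * t23 + t2 * t3)"
    using S1 eq3 by algebra
  then have S2: "k2 * S = v * v2 - t * t23 + t2 * t3"
    using nz by simp
  have "k2 * (t * k12) = k2 * (t1 * v2 - t2 * v1 + t12 * S)"
    using S2 eq2 by algebra
  then have k: "t * k12 = t1 * v2 - t2 * v1 + t12 * S"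
    using nz by simp
  have "v * (t * t123) = v * (t3 * t12 + k1 * v2 - k2 * v1)"
    using eq1 eq3 by algebra
  then have t123: "t * t123 = t3 * t12 + k1 * v2 - k2 * v1"
    using nz by simp
  note c1 = psi_shift[OF nz(1,2,4,6,9,12,13) S1 X1 F13 P1]
  note c2 = psi_shift[OF nz(1,3,4,7,10,12,14) S2 X2 F23 P2]
  note c12 = chi12_closed_form[OF nz(1,2,3,5,11,12,14) k c2(2) F12 X12]
  have k': "t * (- k12) = t2 * v1 - t1 * v2 + (- t12) * S"
    using k by algebra
  have t123': "t * (- t123) = t3 * (- t12) + k2 * v1 - k1 * v2"
    using t123 by algebra
  \<comment> \<open>The two sign changes cancel in the defining equations of \<open>F12\<close> and
    \<open>X12'\<close>, so the interchanged instance concerns the same points.\<close>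
  have c12': "v * t * (- k12) * (X12' - F) = v * (t2 * v1 * (F2 - F) - t1 * v2 * (F1 - F)
      + (- t12) * S * (P - F)) + (- t12) * t * t3 * (F3 - F)"
    by (rule chi12_closed_form[OF _ _ _ _ _ _ _ k' c1(2), where Fij = F12])
       (use nz in \<open>simp_all add: F12 X12' field_simps\<close>)
  have "v * t * k12 * (X12 - F) = v * t * k12 * (X12' - F)"
    using c12 c12' by algebra
  then show X: "X12 = X12'"
    using nz by simp
  show "F3 + t13 * t23 / (t3 * t123) * (F13 - F23) = P2 + k12 * t23 / (v2 * t123) * (X12 - F23)"
    by (rule phi123_consistent[OF _ _ _ _ _ _ _ _ S1 S2 k t123 c1(1) c2(1) c2(2) c12])
       (use nz in simp_all)
  have "F3 + t23 * t13 / (t3 * (- t123)) * (F23 - F13)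
      = P1 + (- k12) * t13 / (v1 * (- t123)) * (X12' - F13)"
    by (rule phi123_consistent[OF _ _ _ _ _ _ _ _ S2 S1 k' t123' c2(1) c1(1) c1(2) c12'])
       (use nz in simp_all)
  moreover have "t23 * t13 / (t3 * (- t123)) = - (t13 * t23 / (t3 * t123))"
    by (simp add: mult.commute[of t23])
  ultimately show
    "F3 + t13 * t23 / (t3 * t123) * (F13 - F23) = P1 + k12 * t13 / (v1 * t123) * (X12 - F13)"
    unfolding X by (simp only: minus_mult_commute minus_diff_eq mult_minus_right minus_divide_divide)
qed

section \<open>Shifts, parallel vectors and multi-ratios\<close>

text \<open>Oriented to sort shifts into the order \<open>s1\<close>, \<open>s2\<close>,
  \<open>s3\<close> from the outside, as in the goal.\<close>

lemma shift_commute: "s2 (s1 n) = s1 (s2 n)" "s3 (s1 n) = s1 (s3 n)" "s3 (s2 n) = s2 (s3 n)"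
  by (simp_all add: s1_def s2_def s3_def split: prod.splits)

text \<open>The four versions cover the vertex orders and argument orders in which the linear
  equations meet the listed edges.\<close>

lemma parallel_of_real_multiple:
  assumes "a - b = complex_of_real r * (c - d)"
  shows "parallel (a - b) (d - c)" "parallel (b - a) (d - c)"
    "parallel (c - d) (a - b)" "parallel (d - c) (a - b)"
proof -
  have "Re (a - b) = r * Re (c - d)" "Im (a - b) = r * Im (c - d)"
    by (simp_all add: assms)
  then show "parallel (a - b) (d - c)" "parallel (b - a) (d - c)"
    "parallel (c - d) (a - b)" "parallel (d - c) (a - b)"
    unfolding parallel_def by (simp_all add: algebra_simps) algebra+
qed

text \<open>Numerator and denominator are scaled by the same nonzero real factor. The cancellation
  also covers a vanishing denominator, as both vanish together and \<open>x / 0 = 0\<close>.\<close>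

lemma M_eqI:
  assumes "Q1 - Q2 = complex_of_real a1 * (P1 - P2)" "Q2 - Q3 = complex_of_real a2 * (P2 - P3)"
    "Q3 - Q4 = complex_of_real a3 * (P3 - P4)" "Q4 - Q5 = complex_of_real a4 * (P4 - P5)"
    "Q5 - Q6 = complex_of_real a5 * (P5 - P6)" "Q6 - Q1 = complex_of_real a6 * (P6 - P1)"
    and "a1 * a3 * a5 = a2 * a4 * a6" "a2 * a4 * a6 \<noteq> 0"
  shows "M P1 P2 P3 P4 P5 P6 = M Q1 Q2 Q3 Q4 Q5 Q6"
proof -
  define c where "c = complex_of_real (a2 * a4 * a6)"
  have "c \<noteq> 0"
    using assms(8) unfolding c_def of_real_eq_0_iff .
  have "(Q1 - Q2) * (Q3 - Q4) * (Q5 - Q6)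
      = complex_of_real (a1 * a3 * a5) * ((P1 - P2) * (P3 - P4) * (P5 - P6))"
    by (simp add: assms(1,3,5))
  moreover have "(Q2 - Q3) * (Q4 - Q5) * (Q6 - Q1) = c * ((P2 - P3) * (P4 - P5) * (P6 - P1))"
    by (simp add: assms(2,4,6) c_def)
  ultimately show ?thesis
    using \<open>c \<noteq> 0\<close> unfolding M_def assms(7) c_def[symmetric] by simp
qed

section \<open>Compatibility and the reciprocal pair\<close>

theorem theorem9:
  fixes \<tau> \<kappa> \<nu> :: "pt \<Rightarrow> real"
  assumes nz: "\<And>n. \<tau> n \<noteq> 0" "\<And>n. \<kappa> n \<noteq> 0" "\<And>n. \<nu> n \<noteq> 0"
    and eq1: "\<And>n. \<nu> n * (\<tau> n * \<tau> (s1 (s2 (s3 n))) - \<tau> (s3 n) * \<tau> (s1 (s2 n)))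
                + \<kappa> (s1 n) * (\<tau> (s2 n) * \<tau> (s3 n) - \<tau> n * \<tau> (s2 (s3 n)))
                + \<kappa> (s2 n) * (\<tau> n * \<tau> (s1 (s3 n)) - \<tau> (s1 n) * \<tau> (s3 n)) = 0"
    and eq2: "\<And>n. \<kappa> (s2 n) * (\<tau> n * \<kappa> (s1 (s2 n)) - \<tau> (s1 n) * \<nu> (s2 n))
                + \<tau> (s2 n) * (\<nu> (s1 n) * \<kappa> (s2 n) - \<tau> (s3 n) * \<tau> (s1 (s2 n)))
                + \<tau> (s1 (s2 n)) * (\<tau> n * \<tau> (s2 (s3 n)) - \<nu> n * \<nu> (s2 n)) = 0"
    and eq3: "\<And>n. \<nu> n * (\<kappa> (s1 n) * \<nu> (s2 n) - \<kappa> (s2 n) * \<nu> (s1 n))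
                + \<kappa> (s1 n) * (\<tau> (s2 n) * \<tau> (s3 n) - \<tau> n * \<tau> (s2 (s3 n)))
                + \<kappa> (s2 n) * (\<tau> n * \<tau> (s1 (s3 n)) - \<tau> (s1 n) * \<tau> (s3 n)) = 0"
  shows "lin_compatible \<tau> \<kappa> \<nu> \<and>
    (\<forall>\<Phi> \<Psi> \<chi>. lin_system \<tau> \<kappa> \<nu> \<Phi> \<Psi> \<chi> \<longrightarrow> (\<forall>n.
       let F = \<Phi> n; F1 = \<Phi> (s1 n); F2 = \<Phi> (s2 n); F3 = \<Phi> (s3 n);
           F12 = \<Phi> (s1 (s2 n)); F13 = \<Phi> (s1 (s3 n)); F23 = \<Phi> (s2 (s3 n));
           F123 = \<Phi> (s1 (s2 (s3 n)));
           P = \<Psi> n; P1 = \<Psi> (s1 n); P2 = \<Psi> (s2 n);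
           X1 = \<chi> (s1 n); X2 = \<chi> (s2 n); X12 = \<chi> (s1 (s2 n))
       in parallel (F2 - F1) (F12 - F) \<and>
          parallel (F1 - P) (X1 - F) \<and>
          parallel (F2 - P) (X2 - F) \<and>
          parallel (F13 - P) (F3 - X1) \<and>
          parallel (F23 - P) (F3 - X2) \<and>
          parallel (F23 - F13) (F123 - F3) \<and>
          parallel (F13 - X12) (F123 - P1) \<and>
          parallel (F23 - X12) (F123 - P2) \<and>
          parallel (F1 - X12) (P1 - F12) \<and>
          parallel (F2 - X12) (P2 - F12) \<and>
          parallel (F13 - F1) (P1 - X1) \<and>
          parallel (F23 - F2) (P2 - X2) \<and>
          M F23 F13 P F1 F2 X12 = M F123 F3 X1 F F12 P2 \<and>
          M F13 F23 P F2 F1 X12 = M F123 F3 X2 F F12 P1 \<and>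
          M X12 F23 F2 P F1 F13 = M F123 P2 X2 F X1 P1))"
proof (intro conjI allI impI, goal_cases)
  case 1
  have nz': "complex_of_real (\<tau> m) \<noteq> 0" "complex_of_real (\<kappa> m) \<noteq> 0"
    "complex_of_real (\<nu> m) \<noteq> 0" for m
    using nz by simp_all
  note eqs = eq1[THEN arg_cong[where f = complex_of_real]] eq2[THEN arg_cong[where f = complex_of_real]]
    eq3[THEN arg_cong[where f = complex_of_real]]
  note cube = cube_consistent[OF nz'(1,1,1,1,1,1,1,1,2,2,2,3,3,3)
      eqs[unfolded of_real_add of_real_mult of_real_diff of_real_0]
      refl refl refl refl refl refl refl refl refl]
  show ?case
    unfolding lin_compatible_def Let_def shift_commute of_real_mult of_real_divide
    by (intro allI conjI) (rule cube)+
next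
  case (2 \<Phi> \<Psi> \<chi> n)
  let ?c = complex_of_real
  note sys = 2[unfolded lin_system_def, rule_format]
  define A where "A m = \<tau> (s1 m) * \<tau> (s2 m) / (\<tau> m * \<tau> (s1 (s2 m)))" for m
  define B1 where "B1 m = \<nu> m * \<tau> (s1 m) / (\<kappa> (s1 m) * \<tau> m)" for m
  define C1 where "C1 m = \<kappa> (s1 m) * \<tau> (s3 m) / (\<nu> m * \<tau> (s1 (s3 m)))" for m
  define B2 where "B2 m = \<nu> m * \<tau> (s2 m) / (\<kappa> (s2 m) * \<tau> m)" for m
  define C2 where "C2 m = \<kappa> (s2 m) * \<tau> (s3 m) / (\<nu> m * \<tau> (s2 (s3 m)))" for m
  define D where "D m = \<tau> m * \<tau> (s3 m) / (\<kappa> m * \<nu> m)" for m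
  note coeffs = A_def B1_def C1_def B2_def C2_def D_def
  have coeffs_nz: "A m \<noteq> 0" "B1 m \<noteq> 0" "C1 m \<noteq> 0" "B2 m \<noteq> 0" "C2 m \<noteq> 0" "D m \<noteq> 0" for m
    using nz by (simp_all add: coeffs)
  have eA: "\<Phi> (s1 (s2 m)) - \<Phi> m = ?c (A m) * (\<Phi> (s1 m) - \<Phi> (s2 m))"
    and eB1: "\<chi> (s1 m) - \<Phi> m = ?c (B1 m) * (\<Phi> (s1 m) - \<Psi> m)"
    and eC1: "\<Phi> (s1 (s3 m)) - \<Psi> m = ?c (C1 m) * (\<chi> (s1 m) - \<Phi> (s3 m))"
    and eB2: "\<chi> (s2 m) - \<Phi> m = ?c (B2 m) * (\<Phi> (s2 m) - \<Psi> m)"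
    and eC2: "\<Phi> (s2 (s3 m)) - \<Psi> m = ?c (C2 m) * (\<chi> (s2 m) - \<Phi> (s3 m))"
    and eD: "\<Psi> m - \<chi> m = ?c (D m) * (\<Phi> (s3 m) - \<Phi> m)" for m
    using sys[of m] unfolding coeffs by blast+
  \<comment> \<open>These twelve instances pair each octahedral edge with its reciprocal hexahedral
    edge.\<close>
  note edges = eA[of n] eA[of "s3 n"] eB1[of n] eB1[of "s2 n"] eC1[of n] eC1[of "s2 n"]
    eB2[of n] eB2[of "s1 n"] eC2[of n] eC2[of "s1 n"] eD[of "s1 n"] eD[of "s2 n"]
  note e = edges[unfolded shift_commute]
  \<comment> \<open>A reciprocal appears where the linear equation expresses an octahedral edge
    through the hexahedral one. A minus sign appears where the two edges are traversed in opposite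
    senses.\<close>
  have M1: "M (\<Phi> (s2 (s3 n))) (\<Phi> (s1 (s3 n))) (\<Psi> n) (\<Phi> (s1 n)) (\<Phi> (s2 n)) (\<chi> (s1 (s2 n)))
    = M (\<Phi> (s1 (s2 (s3 n)))) (\<Phi> (s3 n)) (\<chi> (s1 n)) (\<Phi> n) (\<Phi> (s1 (s2 n))) (\<Psi> (s2 n))"
  proof (rule M_eqI[where ?a1.0 = "- A (s3 n)" and ?a2.0 = "- 1 / C1 n" and ?a3.0 = "- B1 n"
        and ?a4.0 = "- A n" and ?a5.0 = "- 1 / B1 (s2 n)" and ?a6.0 = "- C1 (s2 n)"])
    show "- A (s3 n) * - B1 n * (- 1 / B1 (s2 n)) = - 1 / C1 n * - A n * - C1 (s2 n)"
      using nz by (simp add: coeffs shift_commute field_simps)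
  qed (use e coeffs_nz in \<open>simp_all add: field_simps\<close>)
  have M2: "M (\<Phi> (s1 (s3 n))) (\<Phi> (s2 (s3 n))) (\<Psi> n) (\<Phi> (s2 n)) (\<Phi> (s1 n)) (\<chi> (s1 (s2 n)))
    = M (\<Phi> (s1 (s2 (s3 n)))) (\<Phi> (s3 n)) (\<chi> (s2 n)) (\<Phi> n) (\<Phi> (s1 (s2 n))) (\<Psi> (s1 n))"
  proof (rule M_eqI[where ?a1.0 = "A (s3 n)" and ?a2.0 = "- 1 / C2 n" and ?a3.0 = "- B2 n"
        and ?a4.0 = "A n" and ?a5.0 = "- 1 / B2 (s1 n)" and ?a6.0 = "- C2 (s1 n)"])
    show "A (s3 n) * - B2 n * (- 1 / B2 (s1 n)) = - 1 / C2 n * A n * - C2 (s1 n)"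
      using nz by (simp add: coeffs shift_commute field_simps)
  qed (use e coeffs_nz in \<open>simp_all add: field_simps\<close>)
  \<comment> \<open>Here all six equations give the hexahedral edge, in matching orientation, so
    neither signs nor reciprocals occur.\<close>
  have M3: "M (\<chi> (s1 (s2 n))) (\<Phi> (s2 (s3 n))) (\<Phi> (s2 n)) (\<Psi> n) (\<Phi> (s1 n)) (\<Phi> (s1 (s3 n)))
    = M (\<Phi> (s1 (s2 (s3 n)))) (\<Psi> (s2 n)) (\<chi> (s2 n)) (\<Phi> n) (\<chi> (s1 n)) (\<Psi> (s1 n))"
  proof (rule M_eqI[where ?a1.0 = "C1 (s2 n)" and ?a2.0 = "D (s2 n)" and ?a3.0 = "B2 n"
        and ?a4.0 = "B1 n" and ?a5.0 = "D (s1 n)" and ?a6.0 = "C2 (s1 n)"])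
    show "C1 (s2 n) * B2 n * D (s1 n) = D (s2 n) * B1 n * C2 (s1 n)"
      using nz by (simp add: coeffs shift_commute field_simps)
  qed (use e coeffs_nz in \<open>simp_all add: algebra_simps\<close>)
  note par = e[THEN parallel_of_real_multiple(1)] e[THEN parallel_of_real_multiple(2)]
    e[THEN parallel_of_real_multiple(3)] e[THEN parallel_of_real_multiple(4)]
  show ?case
    unfolding Let_def by (intro conjI) (fact M1 M2 M3 par)+
qed

end
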